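(* Let $\mathcal{M}=(E,r,m)$ be a ranked set with multiplicity. Then, as rational functions in $s,u_e,v_e$, $$\prod_{e\in E}(1-u_e)\;\mathbf{Z}_{\mathcal{M}}\Bigl(s,\bigl(\tfrac{v_e(1-2u_e)}{1-u_e}\bigr)_{e\in E}\Bigr)=\sum_{A\subseteq E}s^{-r(A)}\prod_{e\in A}(-v_e)\;\mathbf{Z}_{\mathcal{M}/A}\bigl(s,(v_e)_{e\in E\setminus A}\bigr)\prod_{e\in A}u_e\prod_{e\in E\setminus A}(1-u_e).$$ Consequently, with $R=\mathbb{R}$ and $p_e\in[0,1]$, $$\mathbb{E}\Bigl[s^{-r(E_{\underline p})}\prod_{e\in E_{\underline p}}(-v_e)\;\mathbf{Z}_{\mathcal{M}/E_{\underline p}}\bigl(s,(v_e)_{e\in E\setminus E_{\underline p}}\bigr)\Bigr]=\prod_{e\in E}(1-p_e)\;\mathbf{Z}_{\mathcal{M}}\Bigl(s,\bigl(\tfrac{v_e(1-2p_e)}{1-p_e}\bigr)_{e\in E}\Bigr).$$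
   Context: A ranked set with multiplicity (rsm) is $\mathcal{M}=(E,r,m)$ with $E$ finite, $r:2^E\to\mathbb{Z}$ arbitrary ($r(\emptyset)$ may be nonzero), $m:2^E\to R$ arbitrary, $R$ a commutative ring with $1$. $\mathbf{Z}_{\mathcal{M}}(q,(v_e))=\sum_{A\subseteq E}m(A)q^{-r(A)}\prod_{e\in A}v_e$. Contraction $\mathcal{M}/A=(E\setminus A,r',m')$ with $r'(B)=r(B\cup A)-r(A)$, $m'(B)=m(B\cup A)$. $E_{\underline p}$ is the random subset containing each $e$ independently with probability $p_e$. The right-hand side of the expectation formula equals the polynomial $\sum_{A\subseteq E}m(A)s^{-r(A)}\prod_{e\in A}v_e(1-2p_e)\prod_{e\in E\setminus A}(1-p_e)$. *)

theory Defs
  imports "HOL-Library.Poly_Mapping" "HOL-Probability.Probability" "HOL-Probability.Product_PMF"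
begin

section \<open>The total ring of fractions of a commutative ring\<close>

text \<open>
  The coefficient ring is an arbitrary commutative ring, possibly with zero divisors, so the
  fraction field of \<open>HOL-Computational_Algebra\<close> (which needs an integral domain) is not
  applicable. The denominators allowed here are the elements that are not zero divisors; with
  such denominators the canonical map from the ring into its ring of fractions is injective.
\<close>

definition regular :: "'a::comm_ring_1 \<Rightarrow> bool" where
  "regular b \<longleftrightarrow> (\<forall>x. b * x = 0 \<longrightarrow> x = 0)"

lemma regular_1 [simp]: "regular 1"
  by (simp add: regular_def)

lemma regular_mult [simp]: "regular a \<Longrightarrow> regular b \<Longrightarrow> regular (a * b)"
  unfolding regular_def by (metis mult.assoc)

lemma regular_cancel:
  assumes "regular c" "c * a = c * b"
  shows "a = b"
proof -
  have "c * (a - b) = 0" using assms(2) by (simp add: right_diff_distrib)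
  then have "a - b = 0" using assms(1) unfolding regular_def by blast
  then show ?thesis by simp
qed

definition tfractrel :: "'a::comm_ring_1 \<times> 'a \<Rightarrow> 'a \<times> 'a \<Rightarrow> bool" where
  "tfractrel x y \<longleftrightarrow> regular (snd x) \<and> regular (snd y) \<and> fst x * snd y = fst y * snd x"

lemma part_equivp_tfractrel: "part_equivp (tfractrel :: 'a::comm_ring_1 \<times> 'a \<Rightarrow> _)"
proof (rule part_equivpI)
  show "\<exists>x::'a \<times> 'a. tfractrel x x"
    by (rule exI[where x = "(0, 1)"]) (simp add: tfractrel_def)
  show "symp (tfractrel :: 'a \<times> 'a \<Rightarrow> _)"
    by (simp add: symp_def tfractrel_def)
  show "transp (tfractrel :: 'a \<times> 'a \<Rightarrow> _)"
  proof (rule transpI)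
    fix x y z :: "'a \<times> 'a"
    assume A: "tfractrel x y" and B: "tfractrel y z"
    have "snd y * (fst x * snd z) = (fst x * snd y) * snd z" by (simp only: ac_simps)
    also have "fst x * snd y = fst y * snd x" using A by (simp only: tfractrel_def)
    also have "(fst y * snd x) * snd z = (fst y * snd z) * snd x" by (simp only: ac_simps)
    also have "fst y * snd z = fst z * snd y" using B by (simp only: tfractrel_def)
    also have "(fst z * snd y) * snd x = snd y * (fst z * snd x)" by (simp only: ac_simps)
    finally have *: "snd y * (fst x * snd z) = snd y * (fst z * snd x)" .
    have "regular (snd y)" using A by (simp add: tfractrel_def)
    from regular_cancel[OF this *] have "fst x * snd z = fst z * snd x" .
    with A B show "tfractrel x z" by (simp add: tfractrel_def)
  qed
qed

quotient_type (overloaded) 'a tfract = "'a::comm_ring_1 \<times> 'a" / partial: tfractrel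
  by (rule part_equivp_tfractrel)

lift_definition TFract :: "'a::comm_ring_1 \<Rightarrow> 'a \<Rightarrow> 'a tfract"
  is "\<lambda>a b. if regular b then (a, b) else (0, 1)"
  by (simp add: tfractrel_def)

lemma TFract_cases [cases type: tfract]:
  obtains (TFract) a b where "q = TFract a b" "regular b"
  by transfer (auto simp: tfractrel_def split: if_splits)

lemma eq_tfract:
  "regular b \<Longrightarrow> regular d \<Longrightarrow> TFract a b = TFract c d \<longleftrightarrow> a * d = c * b"
  by transfer (simp add: tfractrel_def)

instantiation tfract :: (comm_ring_1) comm_ring_1
begin

lift_definition zero_tfract :: "'a tfract" is "(0, 1)" by (simp add: tfractrel_def)

lift_definition one_tfract :: "'a tfract" is "(1, 1)" by (simp add: tfractrel_def)

lift_definition plus_tfract :: "'a tfract \<Rightarrow> 'a tfract \<Rightarrow> 'a tfract"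
  is "\<lambda>q r. (fst q * snd r + fst r * snd q, snd q * snd r)"
proof -
  fix p q r s :: "'a \<times> 'a"
  assume A: "tfractrel p q" and B: "tfractrel r s"
  have "(fst p * snd r + fst r * snd p) * (snd q * snd s)
      = (fst p * snd q) * (snd r * snd s) + (fst r * snd s) * (snd p * snd q)"
    by (simp add: algebra_simps)
  also have "\<dots> = (fst q * snd p) * (snd r * snd s) + (fst s * snd r) * (snd p * snd q)"
    using A B by (simp add: tfractrel_def)
  also have "\<dots> = (fst q * snd s + fst s * snd q) * (snd p * snd r)"
    by (simp add: algebra_simps)
  finally show "tfractrel (fst p * snd r + fst r * snd p, snd p * snd r)
                          (fst q * snd s + fst s * snd q, snd q * snd s)"
    using A B by (simp add: tfractrel_def)
qed

lift_definition uminus_tfract :: "'a tfract \<Rightarrow> 'a tfract" is "\<lambda>x. (- fst x, snd x)"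
  by (simp add: tfractrel_def)

definition minus_tfract :: "'a tfract \<Rightarrow> 'a tfract \<Rightarrow> 'a tfract" where
  "minus_tfract q r = q + - r"

lift_definition times_tfract :: "'a tfract \<Rightarrow> 'a tfract \<Rightarrow> 'a tfract"
  is "\<lambda>q r. (fst q * fst r, snd q * snd r)"
proof -
  fix p q r s :: "'a \<times> 'a"
  assume A: "tfractrel p q" and B: "tfractrel r s"
  have "(fst p * fst r) * (snd q * snd s) = (fst p * snd q) * (fst r * snd s)"
    by (simp add: ac_simps)
  also have "\<dots> = (fst q * snd p) * (fst s * snd r)"
    using A B by (simp add: tfractrel_def)
  also have "\<dots> = (fst q * fst s) * (snd p * snd r)"
    by (simp add: ac_simps)
  finally show "tfractrel (fst p * fst r, snd p * snd r) (fst q * fst s, snd q * snd s)"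
    using A B by (simp add: tfractrel_def)
qed

lemma Zero_tfract_def: "0 = TFract 0 1"
  by transfer (simp add: tfractrel_def)

lemma One_tfract_def: "1 = TFract 1 1"
  by transfer (simp add: tfractrel_def)

lemma add_tfract [simp]:
  "regular b \<Longrightarrow> regular d \<Longrightarrow> TFract a b + TFract c d = TFract (a * d + c * b) (b * d)"
  by transfer (simp add: tfractrel_def)

lemma uminus_tfract [simp]: "regular b \<Longrightarrow> - TFract a b = TFract (- a) b"
  by transfer (simp add: tfractrel_def)

lemma mult_tfract [simp]:
  "regular b \<Longrightarrow> regular d \<Longrightarrow> TFract a b * TFract c d = TFract (a * c) (b * d)"
  by transfer (simp add: tfractrel_def)

instance
proof
  fix q r s :: "'a tfract"
  show "(q * r) * s = q * (r * s)"
    by (cases q, cases r, cases s) (simp add: eq_tfract algebra_simps)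
  show "q * r = r * q"
    by (cases q, cases r) (simp add: eq_tfract algebra_simps)
  show "1 * q = q"
    by (cases q) (simp add: One_tfract_def eq_tfract)
  show "(q + r) + s = q + (r + s)"
    by (cases q, cases r, cases s) (simp add: eq_tfract algebra_simps)
  show "q + r = r + q"
    by (cases q, cases r) (simp add: eq_tfract algebra_simps)
  show "0 + q = q"
    by (cases q) (simp add: Zero_tfract_def eq_tfract)
  show "- q + q = 0"
    by (cases q) (simp add: Zero_tfract_def eq_tfract)
  show "q - r = q + - r"
    by (simp add: minus_tfract_def)
  show "(q + r) * s = q * s + r * s"
    by (cases q, cases r, cases s) (simp add: eq_tfract algebra_simps)
  show "(0::'a tfract) \<noteq> 1"
    by (simp add: Zero_tfract_def One_tfract_def eq_tfract)
qed

end

text \<open>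
  An element \<open>a / b\<close> is invertible iff \<open>a\<close> is not a zero divisor; the inverse of
  a non-invertible element is set to \<open>0\<close> by convention.
\<close>

instantiation tfract :: (comm_ring_1) inverse
begin

lift_definition inverse_tfract :: "'a tfract \<Rightarrow> 'a tfract"
  is "\<lambda>x. if regular (fst x) then (snd x, fst x) else (0, 1)"
proof -
  have *: "regular (fst q)" if "tfractrel p q" "regular (fst p)" for p q :: "'a \<times> 'a"
    unfolding regular_def
  proof (intro allI impI)
    fix x assume "fst q * x = 0"
    then have "(fst q * snd p) * x = 0" 
      by (simp add: mult.commute[of "fst q"] mult.assoc)
    then have "(fst p * snd q) * x = 0" using that(1) by (simp only: tfractrel_def)
    moreover have "regular (fst p * snd q)" using that regular_mult unfolding tfractrel_def by metis
    ultimately show "x = 0" unfolding regular_def by blast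
  qed
  fix p q :: "'a \<times> 'a"
  assume A: "tfractrel p q"
  then have "tfractrel q p" by (simp add: tfractrel_def)
  with A * have "regular (fst p) \<longleftrightarrow> regular (fst q)" by blast
  with A show "tfractrel (if regular (fst p) then (snd p, fst p) else (0, 1))
                         (if regular (fst q) then (snd q, fst q) else (0, 1))"
    by (simp add: tfractrel_def mult.commute[of "snd p"] mult.commute[of "snd q"])
qed

definition divide_tfract :: "'a tfract \<Rightarrow> 'a tfract \<Rightarrow> 'a tfract" where
  "divide_tfract q r = q * inverse r"

instance ..

end

lemma inverse_tfract [simp]: "regular a \<Longrightarrow> regular b \<Longrightarrow> inverse (TFract a b) = TFract b a"
  by transfer (simp add: tfractrel_def)


section \<open>Rational functions in the indeterminates \<open>s\<close>, \<open>u\<^sub>e\<close>, \<open>v\<^sub>e\<close>\<close>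

datatype 'e indet = S_var | U_var 'e | V_var 'e

text \<open>Polynomials over \<open>'r\<close> are finitely supported maps from monomials to coefficients.\<close>

type_synonym ('e, 'r) ratfun = "(('e indet \<Rightarrow>\<^sub>0 nat) \<Rightarrow>\<^sub>0 'r) tfract"

definition rf_const :: "'r::comm_ring_1 \<Rightarrow> ('e, 'r) ratfun" where
  "rf_const c = TFract (Poly_Mapping.single 0 c) 1"

definition rf_var :: "'e indet \<Rightarrow> ('e, 'r::comm_ring_1) ratfun" where
  "rf_var x = TFract (Poly_Mapping.single (Poly_Mapping.single x 1) 1) 1"


section \<open>Ranked sets with multiplicity\<close>

text \<open>
  Only the values of rank and multiplicity on subsets of the ground set are ever used.
\<close>

record ('e, 'r) rsm =
  ground :: "'e set"
  rk :: "'e set \<Rightarrow> int"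
  rsm_mult :: "'e set \<Rightarrow> 'r"

definition contraction :: "('e, 'r) rsm \<Rightarrow> 'e set \<Rightarrow> ('e, 'r) rsm" where
  "contraction M A = \<lparr> ground = ground M - A,
     rk = (\<lambda>B. rk M (B \<union> A) - rk M A),
     rsm_mult = (\<lambda>B. rsm_mult M (B \<union> A)) \<rparr>"

text \<open>
  The first argument is the structure map of the \<open>'r\<close>-algebra \<open>'k\<close> from which the
  values substituted for \<open>q\<close> and \<open>v\<^sub>e\<close> are taken.
\<close>

definition Zpoly ::
  "('r \<Rightarrow> 'k) \<Rightarrow> ('e, 'r) rsm \<Rightarrow> 'k::{comm_ring_1, inverse} \<Rightarrow> ('e \<Rightarrow> 'k) \<Rightarrow> 'k" where
  "Zpoly \<iota> M q v = (\<Sum>A\<in>Pow (ground M). \<iota> (rsm_mult M A) * q powi (- rk M A) * (\<Prod>e\<in>A. v e))"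

definition random_subset :: "'e set \<Rightarrow> ('e \<Rightarrow> real) \<Rightarrow> 'e set pmf" where
  "random_subset E p =
     map_pmf (\<lambda>f. {e \<in> E. f e}) (Pi_pmf E False (\<lambda>e. bernoulli_pmf (p e)))"

end

theory Submission
  imports Defs
begin

text \<open>
  Write \<open>C = A \<union> B\<close> for the subsets \<open>B\<close> of \<open>E - A\<close> indexing the partition function of the
  contraction by \<open>A\<close>. The powers of \<open>s\<close> multiply to \<open>s powi (- rk M C)\<close>, so for fixed \<open>C\<close> only
  the sum of \<open>(\<Prod>e\<in>A. - u e) * (\<Prod>e\<in>E - A. 1 - u e)\<close> over \<open>A \<subseteq> C\<close> remains. By
  the binomial expansion of \<open>\<Prod>e\<in>C. (- u e) + (1 - u e)\<close> it equals
  \<open>(\<Prod>e\<in>C. 1 - 2 * u e) * (\<Prod>e\<in>E - C. 1 - u e)\<close>. This uses only that \<open>s\<close> is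
  invertible; the form with denominators also needs every \<open>1 - u e\<close> to be invertible.
\<close>

section \<open>Integer powers of a unit\<close>

text \<open>The class \<open>inverse\<close> carries no axioms, so the laws of \<open>powi\<close>
  must come from the unit hypothesis. Writing an exponent as a difference of naturals confines the
  sign distinction to this lemma.\<close>

lemma power_int_diff_of_nat_unit:
  fixes x :: "'k::{comm_ring_1, inverse}"
  assumes "x * inverse x = 1"
  shows "x powi (int m - int n) = x ^ m * inverse x ^ n"
proof -
  have unit: "x ^ k * inverse x ^ k = 1" for k
    using assms by (simp flip: power_mult_distrib)
  show ?thesis
  proof (cases "n \<le> m")
    case True
    then obtain k where m: "m = n + k" using le_Suc_ex by blast
    have "x ^ m * inverse x ^ n = x ^ k * (x ^ n * inverse x ^ n)"
      by (simp add: m power_add ac_simps)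
    then show ?thesis by (simp add: m unit)
  next
    case False
    then obtain k where n: "n = m + k" using le_Suc_ex nat_le_linear by blast
    have "x ^ m * inverse x ^ n = inverse x ^ k * (x ^ m * inverse x ^ m)"
      by (simp add: n power_add ac_simps)
    then show ?thesis using False by (simp add: n unit power_int_def)
  qed
qed

lemma power_int_add_unit:
  fixes x :: "'k::{comm_ring_1, inverse}"
  assumes "x * inverse x = 1"
  shows "x powi (i + j) = x powi i * x powi j"
proof -
  obtain a b where i: "i = int a - int b" by (cases i rule: int_diff_cases)
  obtain c d where j: "j = int c - int d" by (cases j rule: int_diff_cases)
  have "i + j = int (a + c) - int (b + d)" by (simp add: i j)
  then have "x powi (i + j) = x ^ (a + c) * inverse x ^ (b + d)"
    by (simp only: power_int_diff_of_nat_unit[OF assms])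
  also have "\<dots> = x powi i * x powi j"
    by (simp add: i j power_int_diff_of_nat_unit[OF assms] power_add ac_simps)
  finally show ?thesis .
qed

section \<open>Regular polynomials and invertible rational functions\<close>

lemma lookup_single_mult_add:
  fixes f :: "'a::cancel_comm_monoid_add \<Rightarrow>\<^sub>0 'r::comm_ring_1"
  shows "Poly_Mapping.lookup (Poly_Mapping.single k c * f) (k + m) = c * Poly_Mapping.lookup f m"
  by (simp add: lookup_mult lookup_single when_mult)

text \<open>Multiplication by a monomial only shifts coefficients, so none is lost. Hence the
  indeterminates become units in the ring of fractions even if the coefficient ring has zero
  divisors.\<close>

lemma regular_single_1:
  "regular (Poly_Mapping.single k 1 :: 'a::cancel_comm_monoid_add \<Rightarrow>\<^sub>0 'r::comm_ring_1)"
  unfolding regular_def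
proof (intro allI impI)
  fix f :: "'a \<Rightarrow>\<^sub>0 'r"
  assume *: "Poly_Mapping.single k 1 * f = 0"
  show "f = 0"
  proof (rule poly_mapping_eqI)
    fix m
    show "Poly_Mapping.lookup f m = Poly_Mapping.lookup 0 m"
      using lookup_single_mult_add[of k 1 f m] by (simp add: *)
  qed
qed

text \<open>
  If \<open>f\<close> is a multiple of itself by a nonconstant monomial, then the exponents of its
  monomials are unbounded.
\<close>

lemma regular_1_minus_single:
  fixes k :: "'x \<Rightarrow>\<^sub>0 nat" and c :: "'r::comm_ring_1"
  assumes "k \<noteq> 0"
  shows "regular (1 - Poly_Mapping.single k c)"
  unfolding regular_def
proof (intro allI impI)
  fix f :: "('x \<Rightarrow>\<^sub>0 nat) \<Rightarrow>\<^sub>0 'r"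
  assume "(1 - Poly_Mapping.single k c) * f = 0"
  then have f: "f = Poly_Mapping.single k c * f" by (simp add: algebra_simps)
  obtain x where x: "Poly_Mapping.lookup k x > 0"
    using assms by (metis gr0I lookup_zero poly_mapping_eqI)
  have ge: "n \<le> Poly_Mapping.lookup m x" if "m \<in> Poly_Mapping.keys f" for m n
    using that
  proof (induction n arbitrary: m)
    case (Suc n)
    then have "m \<in> Poly_Mapping.keys (Poly_Mapping.single k c * f)" using f by simp
    then obtain b where b: "b \<in> Poly_Mapping.keys f" "m = k + b"
      using keys_mult[of "Poly_Mapping.single k c" f] by (auto split: if_splits)
    show ?case using Suc.IH[OF b(1)] x by (simp add: b(2) lookup_add)
  qed simp
  have "m \<notin> Poly_Mapping.keys f" for m
    using ge[of m "Suc (Poly_Mapping.lookup m x)"] by auto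
  then have "Poly_Mapping.keys f = {}" by blast
  then show "f = 0" by simp
qed

lemma TFract_mult_inverse:
  assumes "regular a"
  shows "TFract a 1 * inverse (TFract a 1) = 1"
  using assms by (simp add: One_tfract_def eq_tfract)

lemma rf_var_mult_inverse: "rf_var x * inverse (rf_var x) = 1"
  unfolding rf_var_def by (intro TFract_mult_inverse regular_single_1)

lemma one_minus_rf_var_mult_inverse:
  "(1 - rf_var x) * inverse (1 - rf_var x) = (1 :: ('e, 'r::comm_ring_1) ratfun)"
proof -
  have "(1 - rf_var x :: ('e, 'r) ratfun)
      = TFract (1 - Poly_Mapping.single (Poly_Mapping.single x 1) 1) 1"
    by (simp add: rf_var_def One_tfract_def minus_tfract_def)
  moreover have "Poly_Mapping.single x (1::nat) \<noteq> 0"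
    by (metis lookup_single_eq lookup_zero zero_neq_one)
  ultimately show ?thesis
    by (metis TFract_mult_inverse regular_1_minus_single)
qed

section \<open>Sums over pairs of nested subsets\<close>

lemma sum_Pow_contract:
  fixes u :: "'e \<Rightarrow> 'k::comm_ring_1"
  assumes "finite E" "C \<subseteq> E"
  shows "(\<Sum>A\<in>Pow C. (\<Prod>e\<in>A. - u e) * (\<Prod>e\<in>E - A. 1 - u e))
       = (\<Prod>e\<in>C. 1 - 2 * u e) * (\<Prod>e\<in>E - C. 1 - u e)"
proof -
  have "finite C" using assms finite_subset by blast
  \<comment> \<open>The factors over \<open>E - C\<close> do not depend on \<open>A\<close> and
    leave the sum; the binomial expansion then runs over \<open>C\<close> alone.\<close>
  have split: "(\<Prod>e\<in>E - A. 1 - u e) = (\<Prod>e\<in>C - A. 1 - u e) * (\<Prod>e\<in>E - C. 1 - u e)"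
    if "A \<subseteq> C" for A
  proof -
    have E: "E - A = (C - A) \<union> (E - C)" using that assms by blast
    show ?thesis
      unfolding E by (rule prod.union_disjoint) (use assms \<open>finite C\<close> in auto)
  qed
  have "(\<Sum>A\<in>Pow C. (\<Prod>e\<in>A. - u e) * (\<Prod>e\<in>E - A. 1 - u e))
      = (\<Sum>A\<in>Pow C. (\<Prod>e\<in>A. - u e) * (\<Prod>e\<in>C - A. 1 - u e)) * (\<Prod>e\<in>E - C. 1 - u e)"
    unfolding sum_distrib_right by (intro sum.cong refl, subst split) (auto simp: mult.assoc)
  also have "(\<Sum>A\<in>Pow C. (\<Prod>e\<in>A. - u e) * (\<Prod>e\<in>C - A. 1 - u e)) = (\<Prod>e\<in>C. - u e + (1 - u e))"
    by (rule prod_add[symmetric]) fact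
  also have "\<dots> = (\<Prod>e\<in>C. 1 - 2 * u e)"
    by (intro prod.cong refl) (simp add: algebra_simps)
  finally show ?thesis .
qed

text \<open>The prefactor restores exactly what contraction removes: the rank offset
  \<open>rk M A\<close> and the variables of \<open>A\<close>. What remains is the part of the
  partition function of \<open>M\<close> that comes from sets containing \<open>A\<close>.\<close>

lemma Zpoly_contraction:
  fixes s :: "'k::{comm_ring_1, inverse}"
  assumes "finite (ground M)" "A \<subseteq> ground M" and s: "s * inverse s = 1"
  shows "s powi (- rk M A) * (\<Prod>e\<in>A. v e) * Zpoly \<iota> (contraction M A) s v
       = (\<Sum>C\<in>{C\<in>Pow (ground M). A \<subseteq> C}. \<iota> (rsm_mult M C) * s powi (- rk M C) * (\<Prod>e\<in>C. v e))"
proof -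
  let ?E = "ground M"
  have "s powi (- rk M A) * (\<Prod>e\<in>A. v e) * Zpoly \<iota> (contraction M A) s v
      = (\<Sum>B\<in>Pow (?E - A). \<iota> (rsm_mult M (B \<union> A))
           * (s powi (- rk M A) * s powi (rk M A - rk M (B \<union> A)))
           * ((\<Prod>e\<in>A. v e) * (\<Prod>e\<in>B. v e)))"
    by (simp add: Zpoly_def contraction_def sum_distrib_left ac_simps)
  also have "\<dots> = (\<Sum>B\<in>Pow (?E - A). \<iota> (rsm_mult M (B \<union> A)) * s powi (- rk M (B \<union> A))
           * (\<Prod>e\<in>B \<union> A. v e))"
  proof (intro sum.cong refl)
    fix B assume B: "B \<in> Pow (?E - A)"
    have "finite A" "finite B" using B assms(1,2) by (auto intro: finite_subset)
    then have "(\<Prod>e\<in>B \<union> A. v e) = (\<Prod>e\<in>A. v e) * (\<Prod>e\<in>B. v e)"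
      using B by (subst prod.union_disjoint) (auto simp: mult.commute)
    then show "\<iota> (rsm_mult M (B \<union> A)) * (s powi (- rk M A) * s powi (rk M A - rk M (B \<union> A)))
           * ((\<Prod>e\<in>A. v e) * (\<Prod>e\<in>B. v e))
        = \<iota> (rsm_mult M (B \<union> A)) * s powi (- rk M (B \<union> A)) * (\<Prod>e\<in>B \<union> A. v e)"
      by (simp flip: power_int_add_unit[OF s])
  qed
  also have "\<dots> = (\<Sum>C\<in>{C\<in>Pow ?E. A \<subseteq> C}.
      \<iota> (rsm_mult M C) * s powi (- rk M C) * (\<Prod>e\<in>C. v e))"
    using assms(2)
    \<comment> \<open>Adding and removing \<open>A\<close> are inverse bijections between the
      subsets of \<open>?E - A\<close> and the subsets of \<open>?E\<close> that contain
      \<open>A\<close>.\<close>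
    by (intro sum.reindex_bij_witness[where i = "\<lambda>C. C - A" and j = "\<lambda>B. B \<union> A"])
      (auto simp: Un_absorb2 intro: arg_cong2[where f = "(*)"])
  finally show ?thesis .
qed

text \<open>Being free of the denominators \<open>1 - u e\<close>, this form serves both the
  rational identity and the expectation, including probabilities equal to 1.\<close>

lemma sum_Zpoly_contraction:
  fixes s :: "'k::{comm_ring_1, inverse}"
  assumes fin: "finite (ground M)" and s: "s * inverse s = 1"
  shows "(\<Sum>A\<in>Pow (ground M). s powi (- rk M A) * (\<Prod>e\<in>A. - v e)
             * Zpoly \<iota> (contraction M A) s v
             * (\<Prod>e\<in>A. u e) * (\<Prod>e\<in>ground M - A. 1 - u e))
       = (\<Sum>C\<in>Pow (ground M). \<iota> (rsm_mult M C) * s powi (- rk M C)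
             * (\<Prod>e\<in>C. v e * (1 - 2 * u e)) * (\<Prod>e\<in>ground M - C. 1 - u e))"
proof -
  let ?E = "ground M"
  let ?t = "\<lambda>C. \<iota> (rsm_mult M C) * s powi (- rk M C) * (\<Prod>e\<in>C. v e)"
  let ?w = "\<lambda>A. (\<Prod>e\<in>A. - u e) * (\<Prod>e\<in>?E - A. 1 - u e)"
  have "(\<Sum>A\<in>Pow ?E. s powi (- rk M A) * (\<Prod>e\<in>A. - v e) * Zpoly \<iota> (contraction M A) s v
             * (\<Prod>e\<in>A. u e) * (\<Prod>e\<in>?E - A. 1 - u e))
      = (\<Sum>A\<in>Pow ?E. s powi (- rk M A) * (\<Prod>e\<in>A. v e) * Zpoly \<iota> (contraction M A) s v * ?w A)"
    \<comment> \<open>The signs move from the \<open>v e\<close> to the \<open>u e\<close>, as the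
      binomial expansion requires.\<close>
    by (simp add: prod_uminus ac_simps)
  also have "\<dots> = (\<Sum>A\<in>Pow ?E. \<Sum>C\<in>{C\<in>Pow ?E. A \<subseteq> C}. ?t C * ?w A)"
    by (intro sum.cong refl, subst Zpoly_contraction) (auto simp: fin s sum_distrib_right)
  also have "\<dots> = (\<Sum>C\<in>Pow ?E. \<Sum>A\<in>{A\<in>Pow ?E. A \<subseteq> C}. ?t C * ?w A)"
    using fin by (intro sum.swap_restrict) auto
  also have "\<dots> = (\<Sum>C\<in>Pow ?E. ?t C * (\<Sum>A\<in>Pow C. ?w A))"
  proof (intro sum.cong refl)
    fix C assume "C \<in> Pow ?E"
    then have "{A\<in>Pow ?E. A \<subseteq> C} = Pow C" by auto
    then show "(\<Sum>A\<in>{A\<in>Pow ?E. A \<subseteq> C}. ?t C * ?w A) = ?t C * (\<Sum>A\<in>Pow C. ?w A)"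
      by (simp add: sum_distrib_left)
  qed
  also have "\<dots> = (\<Sum>C\<in>Pow ?E. \<iota> (rsm_mult M C) * s powi (- rk M C)
             * (\<Prod>e\<in>C. v e * (1 - 2 * u e)) * (\<Prod>e\<in>?E - C. 1 - u e))"
    by (intro sum.cong refl) (simp add: sum_Pow_contract fin prod.distrib mult.assoc)
  finally show ?thesis .
qed

text \<open>In the term of \<open>C\<close>, the factors \<open>1 - u e\<close> over
  \<open>C\<close> cancel the denominators and those over the complement survive. The quotient is
  written with \<open>inverse\<close> because no axiom of the class links \<open>/\<close> to it;
  each application unfolds its own division.\<close>

lemma prod_mult_Zpoly:
  fixes s :: "'k::{comm_ring_1, inverse}"
  assumes fin: "finite (ground M)"
    and inv: "\<And>e. e \<in> ground M \<Longrightarrow> (1 - u e) * inverse (1 - u e) = 1"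
  shows "(\<Prod>e\<in>ground M. 1 - u e) * Zpoly \<iota> M s (\<lambda>e. w e * inverse (1 - u e))
       = (\<Sum>C\<in>Pow (ground M). \<iota> (rsm_mult M C) * s powi (- rk M C)
             * (\<Prod>e\<in>C. w e) * (\<Prod>e\<in>ground M - C. 1 - u e))"
  unfolding Zpoly_def sum_distrib_left
proof (intro sum.cong refl)
  let ?E = "ground M"
  fix C assume C: "C \<in> Pow ?E"
  have "(\<Prod>e\<in>?E. 1 - u e) = (\<Prod>e\<in>?E - C. 1 - u e) * (\<Prod>e\<in>C. 1 - u e)"
    using C fin by (intro prod.subset_diff) auto
  moreover have "(\<Prod>e\<in>C. 1 - u e) * (\<Prod>e\<in>C. w e * inverse (1 - u e)) = (\<Prod>e\<in>C. w e)"
    unfolding prod.distrib[symmetric]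
  proof (rule prod.cong[OF refl])
    fix e assume "e \<in> C"
    then have "w e * ((1 - u e) * inverse (1 - u e)) = w e" using C inv by auto
    then show "(1 - u e) * (w e * inverse (1 - u e)) = w e" by (simp only: ac_simps)
  qed
  ultimately show "(\<Prod>e\<in>?E. 1 - u e)
        * (\<iota> (rsm_mult M C) * s powi (- rk M C) * (\<Prod>e\<in>C. w e * inverse (1 - u e)))
      = \<iota> (rsm_mult M C) * s powi (- rk M C) * (\<Prod>e\<in>C. w e) * (\<Prod>e\<in>?E - C. 1 - u e)"
    by (simp add: mult.left_commute mult.assoc flip: \<open>_ = (\<Prod>e\<in>C. w e)\<close>)
qed

section \<open>Distribution of the random subset\<close>

lemma pmf_random_subset:
  assumes "finite E" "A \<subseteq> E" "\<And>e. e \<in> E \<Longrightarrow> 0 \<le> p e \<and> p e \<le> 1"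
  shows "pmf (random_subset E p) A = (\<Prod>e\<in>A. p e) * (\<Prod>e\<in>E - A. 1 - p e)"
proof -
  \<comment> \<open>Here \<open>{e \<in> A}\<close> is the singleton of a truth value: selecting
    exactly \<open>A\<close> prescribes each coordinate in \<open>E\<close>, so the event is a box
    and independence gives a product.\<close>
  have "(\<lambda>f. {e \<in> E. f e}) -` {A} = Pi E (\<lambda>e. {e \<in> A})"
    using assms(2) by auto
  then have "pmf (random_subset E p) A = (\<Prod>e\<in>E. pmf (bernoulli_pmf (p e)) (e \<in> A))"
    using assms(1)
    by (simp add: random_subset_def pmf_map measure_Pi_pmf_Pi measure_pmf_single)
  also have "\<dots> = (\<Prod>e\<in>E - A. pmf (bernoulli_pmf (p e)) (e \<in> A))
                * (\<Prod>e\<in>A. pmf (bernoulli_pmf (p e)) (e \<in> A))"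
    using assms by (intro prod.subset_diff) auto
  also have "\<dots> = (\<Prod>e\<in>E - A. 1 - p e) * (\<Prod>e\<in>A. p e)"
    using assms by (intro arg_cong2[where f = "(*)"] prod.cong) auto
  finally show ?thesis by (simp add: mult.commute)
qed

lemma expectation_random_subset:
  fixes f :: "'e set \<Rightarrow> real"
  assumes "finite E" "\<And>e. e \<in> E \<Longrightarrow> 0 \<le> p e \<and> p e \<le> 1"
  shows "measure_pmf.expectation (random_subset E p) f
       = (\<Sum>A\<in>Pow E. f A * (\<Prod>e\<in>A. p e) * (\<Prod>e\<in>E - A. 1 - p e))"
proof -
  have "measure_pmf.expectation (random_subset E p) f
      = (\<Sum>A\<in>Pow E. f A * pmf (random_subset E p) A)"
    \<comment> \<open>The support lies in the finite set \<open>Pow E\<close>, so the integral is a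
      finite sum.\<close>
    using assms(1) by (intro integral_measure_pmf_real) (auto simp: random_subset_def)
  then show ?thesis
    using assms by (simp add: pmf_random_subset mult.assoc)
qed

text \<open>Since \<open>x / 0 = 0\<close> over the reals, the product form would collapse to 0 if
  some \<open>p e = 1\<close>, whereas the polynomial need not vanish. Hence the product form is
  guarded and the polynomial form holds on the whole range of \<open>p\<close>.\<close>

theorem theorem4p12:
  fixes M :: "('e, 'r::comm_ring_1) rsm" and N :: "('e, real) rsm"
  shows
    "(finite (ground M) \<longrightarrow>
       (let E = ground M;
            s = rf_var S_var :: ('e, 'r) ratfun;
            u = (\<lambda>e. rf_var (U_var e) :: ('e, 'r) ratfun);
            v = (\<lambda>e. rf_var (V_var e) :: ('e, 'r) ratfun)
        in (\<Prod>e\<in>E. 1 - u e) * Zpoly rf_const M s (\<lambda>e. v e * (1 - 2 * u e) / (1 - u e))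
           = (\<Sum>A\<in>Pow E. s powi (- rk M A) * (\<Prod>e\<in>A. - v e)
                * Zpoly rf_const (contraction M A) s v
                * (\<Prod>e\<in>A. u e) * (\<Prod>e\<in>E - A. 1 - u e))))
     \<and>
     (finite (ground N) \<longrightarrow>
       (\<forall>(s::real) (v::'e \<Rightarrow> real) (p::'e \<Rightarrow> real).
          s \<noteq> 0 \<and> (\<forall>e\<in>ground N. 0 \<le> p e \<and> p e \<le> 1) \<longrightarrow>
          (let E = ground N;
               expct = measure_pmf.expectation (random_subset E p)
                 (\<lambda>A. s powi (- rk N A) * (\<Prod>e\<in>A. - v e) * Zpoly id (contraction N A) s v)
           in ((\<forall>e\<in>E. p e \<noteq> 1) \<longrightarrow>
                 expct = (\<Prod>e\<in>E. 1 - p e) * Zpoly id N s (\<lambda>e. v e * (1 - 2 * p e) / (1 - p e)))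
              \<and> expct = (\<Sum>A\<in>Pow E. rsm_mult N A * s powi (- rk N A)
                          * (\<Prod>e\<in>A. v e * (1 - 2 * p e)) * (\<Prod>e\<in>E - A. 1 - p e)))))"
proof (intro conjI impI allI)
  assume "finite (ground M)"
  then show "let E = ground M;
            s = rf_var S_var :: ('e, 'r) ratfun;
            u = (\<lambda>e. rf_var (U_var e) :: ('e, 'r) ratfun);
            v = (\<lambda>e. rf_var (V_var e) :: ('e, 'r) ratfun)
        in (\<Prod>e\<in>E. 1 - u e) * Zpoly rf_const M s (\<lambda>e. v e * (1 - 2 * u e) / (1 - u e))
           = (\<Sum>A\<in>Pow E. s powi (- rk M A) * (\<Prod>e\<in>A. - v e)
                * Zpoly rf_const (contraction M A) s v
                * (\<Prod>e\<in>A. u e) * (\<Prod>e\<in>E - A. 1 - u e))"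
    \<comment> \<open>Both sides rewrite to the same denominator-free sum; the last two facts supply
      the required inverses of \<open>s\<close> and of each \<open>1 - u e\<close>.\<close>
    by (simp only: Let_def divide_tfract_def prod_mult_Zpoly sum_Zpoly_contraction
        rf_var_mult_inverse one_minus_rf_var_mult_inverse)
next
  fix s :: real and v p :: "'e \<Rightarrow> real"
  let ?E = "ground N"
  let ?expct = "measure_pmf.expectation (random_subset ?E p)
    (\<lambda>A. s powi (- rk N A) * (\<Prod>e\<in>A. - v e) * Zpoly id (contraction N A) s v)"
  let ?sum = "\<Sum>A\<in>Pow ?E. rsm_mult N A * s powi (- rk N A)
    * (\<Prod>e\<in>A. v e * (1 - 2 * p e)) * (\<Prod>e\<in>?E - A. 1 - p e)"
  assume fin: "finite ?E" and "s \<noteq> 0 \<and> (\<forall>e\<in>?E. 0 \<le> p e \<and> p e \<le> 1)"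
  then have s: "s * inverse s = 1" and p: "\<And>e. e \<in> ?E \<Longrightarrow> 0 \<le> p e \<and> p e \<le> 1" by auto
  have "?expct = ?sum"
    using sum_Zpoly_contraction[OF fin s, of v id p] by (simp add: expectation_random_subset fin p)
  moreover have "(\<Prod>e\<in>?E. 1 - p e) * Zpoly id N s (\<lambda>e. v e * (1 - 2 * p e) / (1 - p e)) = ?sum"
    if "\<forall>e\<in>?E. p e \<noteq> 1"
    using that prod_mult_Zpoly[OF fin, of p id s "\<lambda>e. v e * (1 - 2 * p e)"]
    by (simp add: divide_inverse)
  ultimately show "let E = ground N;
               expct = measure_pmf.expectation (random_subset E p)
                 (\<lambda>A. s powi (- rk N A) * (\<Prod>e\<in>A. - v e) * Zpoly id (contraction N A) s v)
           in ((\<forall>e\<in>E. p e \<noteq> 1) \<longrightarrow>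
                 expct = (\<Prod>e\<in>E. 1 - p e) * Zpoly id N s (\<lambda>e. v e * (1 - 2 * p e) / (1 - p e)))
              \<and> expct = (\<Sum>A\<in>Pow E. rsm_mult N A * s powi (- rk N A)
                          * (\<Prod>e\<in>A. v e * (1 - 2 * p e)) * (\<Prod>e\<in>E - A. 1 - p e))"
    unfolding Let_def by simp
qed

end
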